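(* Let $(G,q_1,\theta_1)$ and $(\Gamma,q_2,\theta_2)$ be involutive metric groups with $c:=\mathcal{G}(q_1)=-\mathcal{G}(q_2)$ and with an isomorphism $(G^{\theta_1},q_1|_{G^{\theta_1}})\cong(\Gamma^{\theta_2},q_2|_{\Gamma^{\theta_2}})$, by means of which both are identified with one group $(U,q_0)$, regarded as a common subgroup of $G$ and $\Gamma$. Let $S,T,C$ be the $J\times J$ matrices defined in the context. Then $S$, $T$ and $C$ are unitary matrices satisfying $S^2=C$, $(ST)^3=cC$, and $TC=CT$.
   Context: A metric group $(G,q)$ is a finite abelian group $G$ with a map $q:G\to\mathbb{T}=\{z\in\mathbb{C}:|z|=1\}$ such that $q(-g)=q(g)$ and $\langle g,h\rangle_q=q(g+h)q(g)^{-1}q(h)^{-1}$ is a non-degenerate bicharacter. $\mathcal{G}(q)=\frac{1}{\sqrt{|G|}}\sum_{g\in G}q(g)$. An involutive metric group $(G,q,\theta)$ is a metric group with $\theta\in\mathrm{Aut}(G)$, $\theta^2=\mathrm{id}$, $q\circ\theta=q$; $G^\theta=\{g\in G:\theta(g)=g\}$. The subscript of $\langle\cdot,\cdot\rangle_{q_i}$ and of $\theta_i$ is suppressed when clear. Put $a=1/\sqrt{|G|}$, $b=1/\sqrt{|\Gamma|}$. Fix subsets $G_*\subset G$, $\Gamma_*\subset\Gamma$ with $G=U\sqcup G_*\sqcup\theta_1(G_* )$ and $\Gamma=U\sqcup\Gamma_*\sqcup\theta_2(\Gamma_* )$. Let $J=(U\times\{0,\pi\})\sqcup G_*\sqcup\Gamma_*$.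 Involution on $J$: $\overline{(u,0)}=(-u,0)$, $\overline{(u,\pi)}=(-u,\pi)$; $\overline{g}=-g$ if $-g\in G_*$ and $\overline g=\theta_1(-g)$ otherwise; $\overline{\gamma}=-\gamma$ if $-\gamma\in\Gamma_*$ and $\overline\gamma=\theta_2(-\gamma)$ otherwise. With blocks indexed in order by $U\times\{0\}$, $U\times\{\pi\}$, $G_*$, $\Gamma_*$ (row index $u,u,g,\gamma$; column index $u',u',g',\gamma'$; bars denote complex conjugation): $$S=\begin{pmatrix} \frac{a-b}{2}\overline{\langle u,u'\rangle}& \frac{a+b}{2}\overline{\langle u,u'\rangle}&a\overline{\langle u,g'\rangle} &b\overline{\langle u,\gamma'\rangle}\\ \frac{a+b}{2}\overline{\langle u,u'\rangle}& \frac{a-b}{2}\overline{\langle u,u'\rangle}&a\overline{\langle u,g'\rangle} &-b\overline{\langle u,\gamma'\rangle}\\ a\overline{\langle g,u'\rangle}&a\overline{\langle g,u'\rangle}&a(\overline{\langle g,g'\rangle+\langle\theta(g),g'\rangle})&0\\ b\overline{\langle\gamma,u'\rangle}&-b\overline{\langle\gamma,u'\rangle}&0&-b(\overline{\langle\gamma,\gamma'\rangle+\langle\theta(\gamma),\gamma'\rangle}) \end{pmatrix},$$ $T=\mathrm{Diag}(q_0(u),q_0(u),q_1(g),q_2(\gamma))$, and $C_{x,y}=\delta_{x,\overline y}$. *)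

theory Defs
  imports Complex_Main
begin

section \<open>Metric groups\<close>

text \<open>A finite abelian group is a type of class \<open>finite\<close> and \<open>ab_group_add\<close>, written additively.\<close>

definition bicharacter :: "('a::ab_group_add \<Rightarrow> 'a \<Rightarrow> complex) \<Rightarrow> bool" where
  "bicharacter \<beta> \<longleftrightarrow>
     (\<forall>g h. norm (\<beta> g h) = 1) \<and>
     (\<forall>g g' h. \<beta> (g + g') h = \<beta> g h * \<beta> g' h) \<and>
     (\<forall>g h h'. \<beta> g (h + h') = \<beta> g h * \<beta> g h')"

text \<open>One-sided: this is used for symmetric bicharacters only.\<close>

definition nondegenerate :: "('a::ab_group_add \<Rightarrow> 'a \<Rightarrow> complex) \<Rightarrow> bool" where
  "nondegenerate \<beta> \<longleftrightarrow> (\<forall>g. (\<forall>h. \<beta> g h = 1) \<longrightarrow> g = 0)"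

definition pairing :: "('a::ab_group_add \<Rightarrow> complex) \<Rightarrow> 'a \<Rightarrow> 'a \<Rightarrow> complex" where
  "pairing q g h = q (g + h) * inverse (q g) * inverse (q h)"

definition metric_group :: "('a::{finite,ab_group_add} \<Rightarrow> complex) \<Rightarrow> bool" where
  "metric_group q \<longleftrightarrow>
     (\<forall>g. norm (q g) = 1) \<and> (\<forall>g. q (- g) = q g) \<and>
     bicharacter (pairing q) \<and> nondegenerate (pairing q)"

definition gauss_sum :: "('a::{finite,ab_group_add} \<Rightarrow> complex) \<Rightarrow> complex" where
  "gauss_sum q = 1 / complex_of_real (sqrt (real (card (UNIV :: 'a set)))) * (\<Sum>g\<in>UNIV. q g)"

definition involutive_metric_group ::
    "('a::{finite,ab_group_add} \<Rightarrow> complex) \<Rightarrow> ('a \<Rightarrow> 'a) \<Rightarrow> bool" where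
  "involutive_metric_group q \<theta> \<longleftrightarrow>
     metric_group q \<and> additive \<theta> \<and> bij \<theta> \<and> \<theta> \<circ> \<theta> = id \<and> q \<circ> \<theta> = q"

definition fixed :: "('a \<Rightarrow> 'a) \<Rightarrow> 'a set" where
  "fixed \<theta> = {g. \<theta> g = g}"

definition fixed_group_iso ::
    "('g::{finite,ab_group_add} \<Rightarrow> complex) \<Rightarrow> ('g \<Rightarrow> 'g) \<Rightarrow>
     ('h::{finite,ab_group_add} \<Rightarrow> complex) \<Rightarrow> ('h \<Rightarrow> 'h) \<Rightarrow> ('g \<Rightarrow> 'h) \<Rightarrow> bool" where
  "fixed_group_iso q1 \<theta>1 q2 \<theta>2 \<phi> \<longleftrightarrow>
     bij_betw \<phi> (fixed \<theta>1) (fixed \<theta>2) \<and>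
     (\<forall>u\<in>fixed \<theta>1. \<forall>v\<in>fixed \<theta>1. \<phi> (u + v) = \<phi> u + \<phi> v) \<and>
     (\<forall>u\<in>fixed \<theta>1. q2 (\<phi> u) = q1 u)"

definition orbit_section :: "('a \<Rightarrow> 'a) \<Rightarrow> 'a set \<Rightarrow> bool" where
  "orbit_section \<theta> X \<longleftrightarrow>
     UNIV = fixed \<theta> \<union> X \<union> \<theta> ` X \<and>
     fixed \<theta> \<inter> X = {} \<and> fixed \<theta> \<inter> \<theta> ` X = {} \<and> X \<inter> \<theta> ` X = {}"


section \<open>The index set\<close>

text \<open>
  The common subgroup \<open>U\<close> is realised as the fixed subgroup \<open>fixed \<theta>1\<close> of the first group, and
  an isomorphism \<open>\<phi>\<close> onto \<open>fixed \<theta>2\<close> carries it into the second group. In particular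
  \<open>q\<^sub>0\<close> is \<open>q1\<close> on \<open>U\<close>. \<open>U0 u\<close> and \<open>Upi u\<close> stand for \<open>(u, 0)\<close> and \<open>(u, \<pi>)\<close>.
\<close>

datatype ('g, 'h) index = U0 'g | Upi 'g | InG 'g | InGamma 'h

definition index_set :: "('g \<Rightarrow> 'g) \<Rightarrow> 'g set \<Rightarrow> 'h set \<Rightarrow> ('g, 'h) index set" where
  "index_set \<theta>1 Gs \<Gamma>s =
     U0 ` fixed \<theta>1 \<union> Upi ` fixed \<theta>1 \<union> InG ` Gs \<union> InGamma ` \<Gamma>s"

fun index_bar ::
    "('g::ab_group_add \<Rightarrow> 'g) \<Rightarrow> 'g set \<Rightarrow> ('h::ab_group_add \<Rightarrow> 'h) \<Rightarrow> 'h set \<Rightarrow>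
     ('g, 'h) index \<Rightarrow> ('g, 'h) index" where
  "index_bar \<theta>1 Gs \<theta>2 \<Gamma>s (U0 u) = U0 (- u)"
| "index_bar \<theta>1 Gs \<theta>2 \<Gamma>s (Upi u) = Upi (- u)"
| "index_bar \<theta>1 Gs \<theta>2 \<Gamma>s (InG g) = InG (if - g \<in> Gs then - g else \<theta>1 (- g))"
| "index_bar \<theta>1 Gs \<theta>2 \<Gamma>s (InGamma \<gamma>) = InGamma (if - \<gamma> \<in> \<Gamma>s then - \<gamma> else \<theta>2 (- \<gamma>))"


section \<open>Matrices indexed by a finite set\<close>

text \<open>
  A \<open>J \<times> J\<close> matrix is a function of two indices of which only the values on \<open>J \<times> J\<close> matter;
  accordingly, equality of matrices is equality of these values.
\<close>

type_synonym 'i cmatrix = "'i \<Rightarrow> 'i \<Rightarrow> complex"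

definition mat_eq :: "'i set \<Rightarrow> 'i cmatrix \<Rightarrow> 'i cmatrix \<Rightarrow> bool" where
  "mat_eq J A B \<longleftrightarrow> (\<forall>x\<in>J. \<forall>y\<in>J. A x y = B x y)"

definition mat_mult :: "'i set \<Rightarrow> 'i cmatrix \<Rightarrow> 'i cmatrix \<Rightarrow> 'i cmatrix" where
  "mat_mult J A B = (\<lambda>x y. \<Sum>z\<in>J. A x z * B z y)"

definition mat_scale :: "complex \<Rightarrow> 'i cmatrix \<Rightarrow> 'i cmatrix" where
  "mat_scale c A = (\<lambda>x y. c * A x y)"

definition mat_diag :: "('i \<Rightarrow> complex) \<Rightarrow> 'i cmatrix" where
  "mat_diag d = (\<lambda>x y. if x = y then d x else 0)"

definition mat_one :: "'i cmatrix" where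
  "mat_one = mat_diag (\<lambda>_. 1)"

definition mat_adjoint :: "'i cmatrix \<Rightarrow> 'i cmatrix" where
  "mat_adjoint A = (\<lambda>x y. cnj (A y x))"

definition unitary :: "'i set \<Rightarrow> 'i cmatrix \<Rightarrow> bool" where
  "unitary J A \<longleftrightarrow>
     mat_eq J (mat_mult J A (mat_adjoint A)) mat_one \<and>
     mat_eq J (mat_mult J (mat_adjoint A) A) mat_one"

fun mat_power :: "'i set \<Rightarrow> 'i cmatrix \<Rightarrow> nat \<Rightarrow> 'i cmatrix" where
  "mat_power J A 0 = mat_one"
| "mat_power J A (Suc n) = mat_mult J A (mat_power J A n)"


section \<open>The matrices S, T and C\<close>

text \<open>
  In mixed brackets the element of \<open>U\<close> is transported to the second group by \<open>\<phi>\<close>, whereas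
  brackets of two elements of \<open>U\<close> are taken in the first group, with the same result as in the
  second, since \<open>\<phi>\<close> is additive and \<open>q2 \<circ> \<phi> = q1\<close> on \<open>U\<close>.
\<close>

fun S_blocks ::
    "complex \<Rightarrow> complex \<Rightarrow> ('g::ab_group_add \<Rightarrow> complex) \<Rightarrow> ('g \<Rightarrow> 'g) \<Rightarrow>
     ('h::ab_group_add \<Rightarrow> complex) \<Rightarrow> ('h \<Rightarrow> 'h) \<Rightarrow> ('g \<Rightarrow> 'h) \<Rightarrow> ('g, 'h) index cmatrix" where
  "S_blocks a b q1 \<theta>1 q2 \<theta>2 \<phi> (U0 u) (U0 u') =
     (a - b) / 2 * cnj (pairing q1 u u')"
| "S_blocks a b q1 \<theta>1 q2 \<theta>2 \<phi> (U0 u) (Upi u') =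
     (a + b) / 2 * cnj (pairing q1 u u')"
| "S_blocks a b q1 \<theta>1 q2 \<theta>2 \<phi> (U0 u) (InG g') =
     a * cnj (pairing q1 u g')"
| "S_blocks a b q1 \<theta>1 q2 \<theta>2 \<phi> (U0 u) (InGamma \<gamma>') =
     b * cnj (pairing q2 (\<phi> u) \<gamma>')"
| "S_blocks a b q1 \<theta>1 q2 \<theta>2 \<phi> (Upi u) (U0 u') =
     (a + b) / 2 * cnj (pairing q1 u u')"
| "S_blocks a b q1 \<theta>1 q2 \<theta>2 \<phi> (Upi u) (Upi u') =
     (a - b) / 2 * cnj (pairing q1 u u')"
| "S_blocks a b q1 \<theta>1 q2 \<theta>2 \<phi> (Upi u) (InG g') =
     a * cnj (pairing q1 u g')"
| "S_blocks a b q1 \<theta>1 q2 \<theta>2 \<phi> (Upi u) (InGamma \<gamma>') =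
     - b * cnj (pairing q2 (\<phi> u) \<gamma>')"
| "S_blocks a b q1 \<theta>1 q2 \<theta>2 \<phi> (InG g) (U0 u') =
     a * cnj (pairing q1 g u')"
| "S_blocks a b q1 \<theta>1 q2 \<theta>2 \<phi> (InG g) (Upi u') =
     a * cnj (pairing q1 g u')"
| "S_blocks a b q1 \<theta>1 q2 \<theta>2 \<phi> (InG g) (InG g') =
     a * cnj (pairing q1 g g' + pairing q1 (\<theta>1 g) g')"
| "S_blocks a b q1 \<theta>1 q2 \<theta>2 \<phi> (InG g) (InGamma \<gamma>') =
     0"
| "S_blocks a b q1 \<theta>1 q2 \<theta>2 \<phi> (InGamma \<gamma>) (U0 u') =
     b * cnj (pairing q2 \<gamma> (\<phi> u'))"
| "S_blocks a b q1 \<theta>1 q2 \<theta>2 \<phi> (InGamma \<gamma>) (Upi u') =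
     - b * cnj (pairing q2 \<gamma> (\<phi> u'))"
| "S_blocks a b q1 \<theta>1 q2 \<theta>2 \<phi> (InGamma \<gamma>) (InG g') =
     0"
| "S_blocks a b q1 \<theta>1 q2 \<theta>2 \<phi> (InGamma \<gamma>) (InGamma \<gamma>') =
     - b * cnj (pairing q2 \<gamma> \<gamma>' + pairing q2 (\<theta>2 \<gamma>) \<gamma>')"

definition S_mat ::
    "('g::{finite,ab_group_add} \<Rightarrow> complex) \<Rightarrow> ('g \<Rightarrow> 'g) \<Rightarrow>
     ('h::{finite,ab_group_add} \<Rightarrow> complex) \<Rightarrow> ('h \<Rightarrow> 'h) \<Rightarrow> ('g \<Rightarrow> 'h) \<Rightarrow> ('g, 'h) index cmatrix" where
  "S_mat q1 \<theta>1 q2 \<theta>2 \<phi> =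
     S_blocks (1 / complex_of_real (sqrt (real (card (UNIV :: 'g set)))))
       (1 / complex_of_real (sqrt (real (card (UNIV :: 'h set))))) q1 \<theta>1 q2 \<theta>2 \<phi>"

fun T_entry :: "('g \<Rightarrow> complex) \<Rightarrow> ('h \<Rightarrow> complex) \<Rightarrow> ('g, 'h) index \<Rightarrow> complex" where
  "T_entry q1 q2 (U0 u) = q1 u"
| "T_entry q1 q2 (Upi u) = q1 u"
| "T_entry q1 q2 (InG g) = q1 g"
| "T_entry q1 q2 (InGamma \<gamma>) = q2 \<gamma>"

definition T_mat :: "('g \<Rightarrow> complex) \<Rightarrow> ('h \<Rightarrow> complex) \<Rightarrow> ('g, 'h) index cmatrix" where
  "T_mat q1 q2 = mat_diag (T_entry q1 q2)"

definition C_mat ::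
    "('g::ab_group_add \<Rightarrow> 'g) \<Rightarrow> 'g set \<Rightarrow> ('h::ab_group_add \<Rightarrow> 'h) \<Rightarrow> 'h set \<Rightarrow>
     ('g, 'h) index cmatrix" where
  "C_mat \<theta>1 Gs \<theta>2 \<Gamma>s = (\<lambda>x y. if x = index_bar \<theta>1 Gs \<theta>2 \<Gamma>s y then 1 else 0)"

end

theory Submission
  imports Defs
begin

text \<open>
  Let \<open>K\<close> be the disjoint union of the two groups and \<open>\<Theta>\<close> the involution on it given by
  \<open>\<theta>1\<close> and \<open>\<theta>2\<close>. There is a real \<open>J \<times> K\<close> matrix \<open>R\<close> with \<open>R R\<^sup>t = 2\<close> and
  \<open>R\<^sup>t R = 1 + \<Theta>\<close>, so \<open>Z \<mapsto> R Z R\<^sup>t / 2\<close> is a unital star homomorphism on the \<open>K \<times> K\<close> matrices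
  commuting with \<open>\<Theta>\<close>. It sends the direct sum of the Fourier matrix of \<open>G\<close> and the negated
  Fourier matrix of \<open>\<Gamma>\<close> to \<open>S\<close>, and the diagonal matrix of \<open>q1\<close> and \<open>q2\<close> and the permutation
  matrix of negation to \<open>T\<close> and \<open>C\<close>. This reduces everything to the relations of the Weil
  representation of a single metric group; the sign of the Fourier matrix of \<open>\<Gamma>\<close> makes up for the
  opposite Gauss sums.
\<close>

section \<open>Matrices\<close>

lemma mat_mult_diag_right:
  fixes A :: "'k::finite cmatrix"
  shows "mat_mult UNIV A (mat_diag d) = (\<lambda>x y. A x y * d y)"
  by (intro ext) (simp add: mat_mult_def mat_diag_def if_distrib cong: if_cong)

lemma mat_mult_diag_left:
  fixes A :: "'k::finite cmatrix"
  shows "mat_mult UNIV (mat_diag d) A = (\<lambda>x y. d x * A x y)"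
  by (intro ext) (simp add: mat_mult_def mat_diag_def if_distrib if_distribR cong: if_cong)

lemma mat_mult_one_right:
  fixes A :: "'k::finite cmatrix"
  shows "mat_mult UNIV A mat_one = A"
  by (simp add: mat_one_def mat_mult_diag_right)

lemma mat_mult_permutation_left:
  fixes A :: "'k::finite cmatrix"
  assumes "\<And>k. p (p k) = k"
  shows "mat_mult UNIV (\<lambda>x y. if x = p y then 1 else 0) A = (\<lambda>x y. A (p x) y)"
proof (intro ext)
  fix x y
  have "x = p z \<longleftrightarrow> z = p x" for z
    using assms by metis
  then show "mat_mult UNIV (\<lambda>x y. if x = p y then 1 else 0) A x y = A (p x) y"
    by (simp add: mat_mult_def if_distribR if_distrib cong: if_cong)
qed

lemma mat_eq_UNIV: "mat_eq UNIV A B \<longleftrightarrow> A = B"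
  by (auto simp: mat_eq_def fun_eq_iff)

lemma unitary_mat_diag:
  fixes d :: "'k::finite \<Rightarrow> complex"
  assumes "\<And>k. norm (d k) = 1"
  shows "unitary UNIV (mat_diag d)"
proof -
  have "mat_adjoint (mat_diag d) = mat_diag (\<lambda>k. cnj (d k))"
    by (auto simp: mat_adjoint_def mat_diag_def fun_eq_iff)
  moreover have "d k * cnj (d k) = 1" for k
    by (metis assms complex_norm_square of_real_1 one_power2)
  ultimately show ?thesis
    by (simp add: unitary_def mat_mult_diag_left mat_eq_def mat_one_def)
      (simp add: mat_diag_def mult.commute)
qed

lemma unitary_permutation:
  fixes p :: "'k::finite \<Rightarrow> 'k"
  assumes "\<And>k. p (p k) = k"
  shows "unitary UNIV (\<lambda>x y. if x = p y then 1 else 0)"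
proof -
  have "mat_adjoint (\<lambda>x y. if x = p y then 1 else 0) = (\<lambda>x y. if x = p y then 1 else 0)"
    using assms by (auto simp: mat_adjoint_def fun_eq_iff)
  moreover have "p x = p y \<longleftrightarrow> x = y" for x y
    using assms by metis
  ultimately show ?thesis
    by (simp add: unitary_def mat_eq_def mat_one_def mat_diag_def mat_mult_permutation_left[OF assms])
qed

lemma mat_scale_scale: "mat_scale r (mat_scale s A) = mat_scale (r * s) A"
  by (simp add: mat_scale_def mult.assoc)

lemma mat_scale_one: "mat_scale 1 A = A"
  by (simp add: mat_scale_def)

lemma mat_scale_mult:
  "mat_mult J (mat_scale r A) B = mat_scale r (mat_mult J A B)"
  "mat_mult J A (mat_scale r B) = mat_scale r (mat_mult J A B)"
  by (simp_all add: mat_mult_def mat_scale_def sum_distrib_left ac_simps)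

lemma mat_power_scale: "mat_power J (mat_scale r A) n = mat_scale (r ^ n) (mat_power J A n)"
  by (induction n) (simp_all add: mat_scale_one mat_scale_mult mat_scale_scale mult.commute)

lemma unitary_uminus:
  assumes "unitary J A"
  shows "unitary J (mat_scale (-1) A)"
proof -
  have "mat_adjoint (mat_scale (-1) A) = mat_scale (-1) (mat_adjoint A)"
    by (simp add: mat_adjoint_def mat_scale_def)
  then show ?thesis
    using assms by (simp add: unitary_def mat_scale_mult mat_scale_scale mat_scale_one)
qed

section \<open>Compression\<close>

text \<open>This is \<open>R Z R\<^sup>t / 2\<close>. Both sums have the shape
  \<open>R x k * f k\<close>, so a rule evaluating one row of \<open>R\<close> against a function
  computes an entry in two rewrites.\<close>

definition compress :: "('i \<Rightarrow> 'k \<Rightarrow> complex) \<Rightarrow> 'k::finite cmatrix \<Rightarrow> 'i cmatrix" where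
  "compress R Z = (\<lambda>x y. (\<Sum>k\<in>UNIV. R x k * (\<Sum>l\<in>UNIV. R y l * Z k l)) / 2)"

text \<open>At a fixed point of \<open>\<Theta>\<close> both indicators in \<open>R_columns\<close>
  hold, so such a column has squared length 2, and any other column has squared length 1.\<close>

locale compression =
  fixes J :: "'i set" and R :: "'i \<Rightarrow> 'k::finite \<Rightarrow> complex" and \<Theta> :: "'k \<Rightarrow> 'k"
  assumes involution: "\<Theta> (\<Theta> k) = k"
    and cnj_R: "cnj (R x k) = R x k"
    and R_invariant: "x \<in> J \<Longrightarrow> R x (\<Theta> k) = R x k"
    and R_rows: "x \<in> J \<Longrightarrow> y \<in> J \<Longrightarrow> (\<Sum>k\<in>UNIV. R x k * R y k) = (if x = y then 2 else 0)"
    and R_columns: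
      "(\<Sum>z\<in>J. R z k * R z l) = (if l = k then 1 else 0) + (if l = \<Theta> k then 1 else 0)"
begin

text \<open>Equivariance is bundled with the equation because compression is multiplicative on
  equivariant matrices; the equation concerns only the values on \<open>J\<close>.\<close>

definition compresses :: "'k cmatrix \<Rightarrow> 'i cmatrix \<Rightarrow> bool" where
  "compresses Z A \<longleftrightarrow> (\<forall>k l. Z (\<Theta> k) (\<Theta> l) = Z k l) \<and> mat_eq J A (compress R Z)"

lemma sum_reindex_involution: "(\<Sum>k\<in>UNIV. f (\<Theta> k)) = (\<Sum>k\<in>UNIV. f k)"
  by (rule sum.reindex_bij_witness[of _ \<Theta> \<Theta>]) (auto simp: involution)

text \<open>The inner factor \<open>R\<^sup>t R\<close> is \<open>1 + \<Theta>\<close>. Equivariance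
  of \<open>W\<close> moves \<open>\<Theta>\<close> past \<open>W\<close> to the outer
  \<open>R\<^sup>t\<close>, which absorbs it, so the inner factor acts as 2 and cancels one of the
  two halves.\<close>

lemma compress_mult:
  assumes W: "\<And>k l. W (\<Theta> k) (\<Theta> l) = W k l" and "y \<in> J"
  shows "mat_mult J (compress R Z) (compress R W) x y = compress R (mat_mult UNIV Z W) x y"
proof -
  \<comment> \<open>The vector \<open>v\<close> is \<open>W\<close> applied to row \<open>y\<close>
    of \<open>R\<close>; it inherits invariance under \<open>\<Theta>\<close> from both.\<close>
  define v where "v m = (\<Sum>n\<in>UNIV. R y n * W m n)" for m
  have v: "v (\<Theta> m) = v m" for m
    unfolding v_def by (subst sum_reindex_involution[symmetric]) (simp add: W R_invariant \<open>y \<in> J\<close>)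
  define w where "w l = (\<Sum>k\<in>UNIV. R x k * Z k l)" for l
  have compress_right: "compress R W z y = (\<Sum>m\<in>UNIV. R z m * v m) / 2" for z
    by (simp only: compress_def v_def)
  have compress_left: "compress R Z x z = (\<Sum>l\<in>UNIV. R z l * w l) / 2" for z
    unfolding compress_def w_def sum_distrib_left by (subst sum.swap) (simp add: ac_simps)
  \<comment> \<open>This is \<open>(1 + \<Theta>) v = 2 v\<close> for the invariant vector
    \<open>v\<close>.\<close>
  have folding: "(\<Sum>m\<in>UNIV. (\<Sum>z\<in>J. R z l * R z m) * v m) = 2 * v l" for l
  proof -
    have "(\<Sum>z\<in>J. R z l * R z m) * v m = (if m = l then v l else 0) + (if m = \<Theta> l then v l else 0)" for m
      by (auto simp: R_columns v)
    then show ?thesis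
      by (simp add: sum.distrib)
  qed
  have "(\<Sum>z\<in>J. (\<Sum>l\<in>UNIV. R z l * w l) * (\<Sum>m\<in>UNIV. R z m * v m)) =
      (\<Sum>z\<in>J. \<Sum>l\<in>UNIV. \<Sum>m\<in>UNIV. w l * (R z l * R z m * v m))"
    unfolding sum_product by (simp only: mult_ac)
  also have "\<dots> = (\<Sum>l\<in>UNIV. \<Sum>z\<in>J. \<Sum>m\<in>UNIV. w l * (R z l * R z m * v m))"
    by (rule sum.swap)
  also have "\<dots> = (\<Sum>l\<in>UNIV. \<Sum>m\<in>UNIV. \<Sum>z\<in>J. w l * (R z l * R z m * v m))"
    by (rule sum.cong[OF refl], rule sum.swap)
  also have "\<dots> = (\<Sum>l\<in>UNIV. w l * (\<Sum>m\<in>UNIV. (\<Sum>z\<in>J. R z l * R z m) * v m))"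
    by (simp only: sum_distrib_left sum_distrib_right)
  also have "\<dots> = 2 * (\<Sum>l\<in>UNIV. w l * v l)"
    unfolding folding by (simp add: mult.left_commute[of _ 2] flip: sum_distrib_left)
  finally have "mat_mult J (compress R Z) (compress R W) x y = (\<Sum>l\<in>UNIV. w l * v l) / 2"
    by (simp add: mat_mult_def compress_left compress_right flip: sum_divide_distrib)
  moreover have "(\<Sum>l\<in>UNIV. w l * v l) = (\<Sum>k\<in>UNIV. R x k * (\<Sum>l\<in>UNIV. Z k l * v l))"
    unfolding w_def sum_distrib_left sum_distrib_right by (subst sum.swap) (simp only: mult_ac)
  moreover have "(\<Sum>l\<in>UNIV. Z k l * v l) = (\<Sum>n\<in>UNIV. R y n * (\<Sum>l\<in>UNIV. Z k l * W l n))" for k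
    unfolding v_def sum_distrib_left by (subst sum.swap) (simp only: mult_ac)
  ultimately show ?thesis
    by (simp only: compress_def mat_mult_def)
qed

lemma compresses_mult:
  assumes "compresses Z A" "compresses W B"
  shows "compresses (mat_mult UNIV Z W) (mat_mult J A B)"
proof -
  have "mat_mult UNIV Z W (\<Theta> k) (\<Theta> l) = mat_mult UNIV Z W k l" for k l
    unfolding mat_mult_def
    by (subst sum_reindex_involution[symmetric]) (use assms in \<open>simp add: compresses_def\<close>)
  moreover have "mat_mult J A B x y = compress R (mat_mult UNIV Z W) x y"
    if "x \<in> J" "y \<in> J" for x y
  proof -
    have "mat_mult J A B x y = mat_mult J (compress R Z) (compress R W) x y"
      unfolding mat_mult_def
      by (rule sum.cong) (use assms that in \<open>simp_all add: compresses_def mat_eq_def\<close>)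
    then show ?thesis
      using compress_mult assms(2) that(2) by (simp add: compresses_def)
  qed
  ultimately show ?thesis
    by (simp add: compresses_def mat_eq_def)
qed

lemma compresses_one: "compresses mat_one mat_one"
proof -
  have "\<Theta> k = \<Theta> l \<longleftrightarrow> k = l" for k l
    by (metis involution)
  then show ?thesis
    by (auto simp: compresses_def mat_eq_def compress_def mat_one_def mat_diag_def R_rows
        if_distrib cong: if_cong)
qed

lemma compresses_adjoint:
  assumes "compresses Z A"
  shows "compresses (mat_adjoint Z) (mat_adjoint A)"
proof -
  have "cnj (compress R Z y x) = compress R (mat_adjoint Z) x y" for x y
    unfolding compress_def mat_adjoint_def
    by (simp add: cnj_R sum_distrib_left, subst sum.swap, simp add: ac_simps)
  then show ?thesis
    using assms by (auto simp: compresses_def mat_eq_def mat_adjoint_def)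
qed

lemma compresses_scale: "compresses Z A \<Longrightarrow> compresses (mat_scale r Z) (mat_scale r A)"
  by (simp add: compresses_def mat_eq_def mat_scale_def compress_def sum_distrib_left ac_simps)

lemma compresses_power: "compresses Z A \<Longrightarrow> compresses (mat_power UNIV Z n) (mat_power J A n)"
  by (induction n) (simp_all add: compresses_one compresses_mult)

text \<open>The transfer principle: two matrices over \<open>J\<close> built in parallel with equal
  expressions upstairs agree on \<open>J\<close>.\<close>

lemma compresses_eq: "compresses Z A \<Longrightarrow> compresses Z B \<Longrightarrow> mat_eq J A B"
  by (simp add: compresses_def mat_eq_def)

lemma compresses_unitary:
  assumes "compresses Z A" "unitary UNIV Z"
  shows "unitary J A"
proof -
  have "mat_mult UNIV Z (mat_adjoint Z) = mat_one" "mat_mult UNIV (mat_adjoint Z) Z = mat_one"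
    using assms(2) by (simp_all add: unitary_def mat_eq_UNIV)
  then show ?thesis
    using compresses_mult compresses_adjoint compresses_eq compresses_one assms(1)
    unfolding unitary_def by metis
qed

end

section \<open>Fourier matrices of metric groups\<close>

lemma metric_group_norm: "metric_group q \<Longrightarrow> norm (q g) = 1"
  by (simp add: metric_group_def)

lemma metric_group_uminus: "metric_group q \<Longrightarrow> q (- g) = q g"
  by (simp add: metric_group_def)

lemma pairing_commute: "pairing q g h = pairing q h g"
  by (simp add: pairing_def ac_simps)

lemma pairing_add_left: "metric_group q \<Longrightarrow> pairing q (g + g') h = pairing q g h * pairing q g' h"
  by (simp add: metric_group_def bicharacter_def)

lemma pairing_add_right: "metric_group q \<Longrightarrow> pairing q g (h + h') = pairing q g h * pairing q g h'"
  by (simp add: metric_group_def bicharacter_def)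

lemma norm_pairing: "metric_group q \<Longrightarrow> norm (pairing q g h) = 1"
  by (simp add: metric_group_def bicharacter_def)

lemma pairing_zero_left:
  assumes "metric_group q"
  shows "pairing q 0 h = 1"
  using pairing_add_left[OF assms, of 0 0 h] norm_pairing[OF assms, of 0 h] by auto

lemma cnj_mult_self: "norm z = 1 \<Longrightarrow> cnj z * z = 1"
  by (metis complex_norm_square mult.commute of_real_1 one_power2)

lemma pairing_uminus_left:
  assumes "metric_group q"
  shows "pairing q (- g) h = cnj (pairing q g h)"
proof -
  have "pairing q (- g) h * pairing q g h = cnj (pairing q g h) * pairing q g h"
    using pairing_add_left[OF assms, of "- g" g h]
    by (simp add: pairing_zero_left cnj_mult_self norm_pairing assms)
  moreover have "pairing q g h \<noteq> 0"
    using norm_pairing[OF assms, of g h] by auto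
  ultimately show ?thesis
    by simp
qed

lemma pairing_uminus_right:
  "metric_group q \<Longrightarrow> pairing q g (- h) = cnj (pairing q g h)"
  using pairing_uminus_left[of q h g] by (simp add: pairing_commute)

text \<open>For \<open>m\<close> nonzero, non-degeneracy gives a point \<open>h0\<close> with
  bracket different from 1. Translating the sum by \<open>h0\<close> multiplies it by that value, so
  it vanishes.\<close>

lemma sum_pairing:
  fixes q :: "'a::{finite,ab_group_add} \<Rightarrow> complex"
  assumes "metric_group q"
  shows "(\<Sum>h\<in>UNIV. pairing q m h) = (if m = 0 then of_nat (card (UNIV :: 'a set)) else 0)"
proof (cases "m = 0")
  case True
  then show ?thesis
    by (simp add: pairing_zero_left assms)
next
  case False
  then obtain h0 where h0: "pairing q m h0 \<noteq> 1"
    using assms unfolding metric_group_def nondegenerate_def by blast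
  have "(\<Sum>h\<in>UNIV. pairing q m h) = (\<Sum>h\<in>UNIV. pairing q m (h + h0))"
    by (rule sum.reindex_bij_witness[of _ "\<lambda>h. h + h0" "\<lambda>h. h - h0"]) auto
  also have "\<dots> = (\<Sum>h\<in>UNIV. pairing q m h) * pairing q m h0"
    by (simp add: pairing_add_right assms sum_distrib_right)
  finally show ?thesis
    using h0 False by simp
qed

section \<open>Weil relations for the Fourier matrix, the diagonal of \<open>q\<close> and
  negation\<close>

definition fourier_scale :: "'a itself \<Rightarrow> complex" where
  "fourier_scale _ = 1 / complex_of_real (sqrt (real (card (UNIV :: 'a set))))"

text \<open>The bracket is conjugated to match the blocks of \<open>S\<close>; the scale is the
  constant \<open>a\<close> at type \<open>'g\<close> and \<open>b\<close> at type
  \<open>'h\<close>.\<close>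

definition fourier :: "('a::{finite,ab_group_add} \<Rightarrow> complex) \<Rightarrow> 'a cmatrix" where
  "fourier q g h = fourier_scale TYPE('a) * cnj (pairing q g h)"

definition negation :: "'a::ab_group_add cmatrix" where
  "negation = (\<lambda>g h. if g = - h then 1 else 0)"

lemma fourier_scale_sq:
  "fourier_scale TYPE('a::finite) * fourier_scale TYPE('a) * of_nat (card (UNIV :: 'a set)) = 1"
proof -
  have "complex_of_real (sqrt (real n)) * complex_of_real (sqrt (real n)) = of_nat n" for n
    by (simp flip: of_real_mult)
  then show ?thesis
    by (simp add: fourier_scale_def)
qed

lemma fourier_sq:
  fixes q :: "'a::{finite,ab_group_add} \<Rightarrow> complex"
  assumes "metric_group q"
  shows "mat_mult UNIV (fourier q) (fourier q) = negation"
proof (intro ext)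
  fix g k :: 'a
  let ?a = "fourier_scale TYPE('a)"
  have "mat_mult UNIV (fourier q) (fourier q) g k =
      ?a * ?a * (\<Sum>h\<in>UNIV. cnj (pairing q g h * pairing q k h))"
    by (simp add: mat_mult_def fourier_def sum_distrib_left pairing_commute[of q _ k] ac_simps)
  also have "(\<Sum>h\<in>UNIV. cnj (pairing q g h * pairing q k h)) = cnj (\<Sum>h\<in>UNIV. pairing q (g + k) h)"
    by (simp add: pairing_add_left assms)
  finally show "mat_mult UNIV (fourier q) (fourier q) g k = negation g k"
    by (simp add: sum_pairing assms negation_def fourier_scale_sq eq_neg_iff_add_eq_0)
qed

lemma fourier_adjoint_left:
  assumes "metric_group q"
  shows "mat_adjoint (fourier q) g h = fourier q (- g) h"
  by (simp add: mat_adjoint_def fourier_def pairing_uminus_left assms pairing_commute[of q h]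
      fourier_scale_def)

lemma fourier_adjoint_right:
  assumes "metric_group q"
  shows "mat_adjoint (fourier q) g h = fourier q g (- h)"
  by (simp add: fourier_adjoint_left assms fourier_def pairing_uminus_left pairing_uminus_right)

text \<open>Taking the adjoint negates one argument, so both products with the adjoint are the
  square of the Fourier matrix, which is \<open>negation\<close>, with one argument negated.\<close>

lemma unitary_fourier:
  fixes q :: "'a::{finite,ab_group_add} \<Rightarrow> complex"
  assumes "metric_group q"
  shows "unitary UNIV (fourier q)"
proof -
  have "mat_mult UNIV (fourier q) (mat_adjoint (fourier q)) g h = mat_mult UNIV (fourier q) (fourier q) g (- h)"
    for g h
    by (simp add: mat_mult_def fourier_adjoint_right assms)
  moreover have "mat_mult UNIV (mat_adjoint (fourier q)) (fourier q) g h = mat_mult UNIV (fourier q) (fourier q) (- g) h"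
    for g h
    by (simp add: mat_mult_def fourier_adjoint_left assms)
  ultimately show ?thesis
    by (auto simp: unitary_def mat_eq_def fourier_sq assms negation_def mat_one_def mat_diag_def)
qed

text \<open>Completing the square: with \<open>F\<close> the Fourier matrix and \<open>D\<close> the
  diagonal of \<open>q\<close>, this is
  \<open>F D F = gauss_sum q * D\<^sup>-\<^sup>1 F D\<^sup>-\<^sup>1\<close>.\<close>

lemma fourier_diag_fourier:
  fixes q :: "'a::{finite,ab_group_add} \<Rightarrow> complex"
  assumes "metric_group q"
  shows "(\<Sum>m\<in>UNIV. fourier q h m * q m * fourier q m k) =
    gauss_sum q * (cnj (q h) * fourier q h k * cnj (q k))"
proof -
  let ?a = "fourier_scale TYPE('a)"
  have nz: "q g \<noteq> 0" for g
    using metric_group_norm[OF assms, of g] by auto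
  have cnj_q: "cnj (q g) = inverse (q g)" for g
    using cnj_mult_self[OF metric_group_norm[OF assms, of g]] inverse_unique[of "q g" "cnj (q g)"]
    by (simp add: mult.commute)
  \<comment> \<open>Expand \<open>q (m - n)\<close> by the bracket of \<open>m\<close> and
    \<open>- n\<close>, using that \<open>q\<close> is even. Below, \<open>n\<close> is
    \<open>h + k\<close>, and translation by it turns the sum over \<open>m\<close> into the Gauss
    sum.\<close>
  have shift: "q m * cnj (pairing q m n) = q (m - n) * cnj (q n)" for m n
    unfolding pairing_uminus_right[OF assms, symmetric]
    using nz by (simp add: pairing_def cnj_q metric_group_uminus[OF assms])
  have "(\<Sum>m\<in>UNIV. fourier q h m * q m * fourier q m k) =
      ?a * ?a * (\<Sum>m\<in>UNIV. q m * cnj (pairing q m (h + k)))"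
    by (simp add: fourier_def sum_distrib_left pairing_add_right assms pairing_commute[of q h] ac_simps)
  also have "\<dots> = ?a * ?a * (\<Sum>m\<in>UNIV. q (m - (h + k))) * cnj (q (h + k))"
    by (simp add: shift sum_distrib_right)
  also have "(\<Sum>m\<in>UNIV. q (m - (h + k))) = (\<Sum>m\<in>UNIV. q m)"
    by (rule sum.reindex_bij_witness[of _ "\<lambda>m. m + (h + k)" "\<lambda>m. m - (h + k)"]) auto
  also have "?a * ?a * (\<Sum>m\<in>UNIV. q m) = ?a * gauss_sum q"
    by (simp add: gauss_sum_def fourier_scale_def)
  also have "cnj (q (h + k)) = cnj (q h) * cnj (pairing q h k) * cnj (q k)"
    using nz by (simp add: pairing_def)
  finally show ?thesis
    by (simp add: fourier_def)
qed

text \<open>The preceding relation gives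
  \<open>(F D)\<^sup>2 = gauss_sum q * D\<^sup>-\<^sup>1 F\<close>; multiplying by
  \<open>F D\<close> on the left cancels the diagonals and leaves \<open>F\<^sup>2\<close>.\<close>

lemma fourier_diag_cube:
  fixes q :: "'a::{finite,ab_group_add} \<Rightarrow> complex"
  assumes "metric_group q"
  shows "mat_power UNIV (mat_mult UNIV (fourier q) (mat_diag q)) 3 = mat_scale (gauss_sum q) negation"
proof -
  let ?X = "mat_mult UNIV (fourier q) (mat_diag q)"
  have q1: "q g * cnj (q g) = 1" for g
    using cnj_mult_self[OF metric_group_norm[OF assms, of g]] by (simp add: mult.commute)
  have sq: "mat_mult UNIV ?X ?X = (\<lambda>h k. gauss_sum q * (cnj (q h) * fourier q h k))"
  proof (intro ext)
    fix h k
    have "mat_mult UNIV ?X ?X h k = (\<Sum>m\<in>UNIV. fourier q h m * q m * fourier q m k) * q k"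
      by (simp only: mat_mult_diag_right) (simp add: mat_mult_def sum_distrib_left ac_simps)
    also have "\<dots> = gauss_sum q * (cnj (q h) * fourier q h k) * (q k * cnj (q k))"
      unfolding fourier_diag_fourier[OF assms] by (simp only: ac_simps)
    finally show "mat_mult UNIV ?X ?X h k = gauss_sum q * (cnj (q h) * fourier q h k)"
      by (simp add: q1)
  qed
  have "mat_mult UNIV ?X (mat_mult UNIV ?X ?X) g k =
      gauss_sum q * mat_mult UNIV (fourier q) (fourier q) g k" for g k
  proof -
    have "mat_mult UNIV ?X (mat_mult UNIV ?X ?X) g k =
        (\<Sum>h\<in>UNIV. (q h * cnj (q h)) * (gauss_sum q * (fourier q g h * fourier q h k)))"
      unfolding sq by (simp only: mat_mult_diag_right) (simp add: mat_mult_def ac_simps)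
    then show ?thesis
      by (simp add: q1 mat_mult_def sum_distrib_left)
  qed
  then show ?thesis
    by (intro ext) (simp add: eval_nat_numeral mat_mult_one_right fourier_sq assms mat_scale_def)
qed

lemma diag_negation_commute:
  fixes q :: "'a::{finite,ab_group_add} \<Rightarrow> complex"
  assumes "metric_group q"
  shows "mat_mult UNIV (mat_diag q) negation = mat_mult UNIV negation (mat_diag q)"
  by (intro ext) (simp add: mat_mult_diag_left mat_mult_diag_right negation_def
      metric_group_uminus[OF assms])

lemma pairing_involution:
  assumes "involutive_metric_group q \<theta>"
  shows "pairing q (\<theta> g) (\<theta> h) = pairing q g h"
proof -
  have "q (\<theta> g) = q g" for g
    using assms by (metis involutive_metric_group_def comp_apply)
  moreover have "\<theta> (g + h) = \<theta> g + \<theta> h"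
    using assms by (simp add: involutive_metric_group_def additive.add)
  ultimately show ?thesis
    by (metis pairing_def)
qed

section \<open>Direct sums\<close>

fun direct_sum :: "'g cmatrix \<Rightarrow> 'h cmatrix \<Rightarrow> ('g + 'h) cmatrix" where
  "direct_sum A B (Inl x) (Inl y) = A x y"
| "direct_sum A B (Inr x) (Inr y) = B x y"
| "direct_sum A B (Inl x) (Inr y) = 0"
| "direct_sum A B (Inr x) (Inl y) = 0"

lemma sum_UNIV_plus:
  fixes f :: "'g::finite + 'h::finite \<Rightarrow> complex"
  shows "(\<Sum>k\<in>UNIV. f k) = (\<Sum>x\<in>UNIV. f (Inl x)) + (\<Sum>y\<in>UNIV. f (Inr y))"
  by (subst UNIV_Plus_UNIV[symmetric], subst sum.Plus) (simp_all add: comp_def)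

lemma direct_sum_eqI:
  assumes "\<And>x y. M (Inl x) (Inl y) = A x y" "\<And>x y. M (Inr x) (Inr y) = B x y"
    "\<And>x y. M (Inl x) (Inr y) = 0" "\<And>x y. M (Inr x) (Inl y) = 0"
  shows "M = direct_sum A B"
proof (intro ext)
  fix k l
  show "M k l = direct_sum A B k l"
    by (cases k; cases l) (simp_all add: assms)
qed

lemma mat_mult_direct_sum:
  fixes A A' :: "'g::finite cmatrix" and B B' :: "'h::finite cmatrix"
  shows "mat_mult UNIV (direct_sum A B) (direct_sum A' B') =
    direct_sum (mat_mult UNIV A A') (mat_mult UNIV B B')"
  by (rule direct_sum_eqI) (simp_all add: mat_mult_def sum_UNIV_plus)

lemma mat_diag_direct_sum: "mat_diag (case_sum d e) = direct_sum (mat_diag d) (mat_diag e)"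
  by (rule direct_sum_eqI) (simp_all add: mat_diag_def)

lemma mat_one_direct_sum: "mat_one = direct_sum mat_one mat_one"
  by (rule direct_sum_eqI) (simp_all add: mat_one_def mat_diag_def)

lemma mat_adjoint_direct_sum:
  "mat_adjoint (direct_sum A B) = direct_sum (mat_adjoint A) (mat_adjoint B)"
  by (rule direct_sum_eqI) (simp_all add: mat_adjoint_def)

lemma mat_scale_direct_sum:
  "mat_scale r (direct_sum A B) = direct_sum (mat_scale r A) (mat_scale r B)"
  by (rule direct_sum_eqI) (simp_all add: mat_scale_def)

lemma mat_power_direct_sum:
  fixes A :: "'g::finite cmatrix" and B :: "'h::finite cmatrix"
  shows "mat_power UNIV (direct_sum A B) n = direct_sum (mat_power UNIV A n) (mat_power UNIV B n)"
proof (induction n)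
  case 0
  show ?case
    by (simp only: mat_power.simps) (rule mat_one_direct_sum)
qed (simp add: mat_mult_direct_sum)

lemma unitary_direct_sum:
  fixes A :: "'g::finite cmatrix" and B :: "'h::finite cmatrix"
  assumes "unitary UNIV A" "unitary UNIV B"
  shows "unitary UNIV (direct_sum A B)"
proof -
  have "mat_mult UNIV A (mat_adjoint A) = mat_one" "mat_mult UNIV (mat_adjoint A) A = mat_one"
    "mat_mult UNIV B (mat_adjoint B) = mat_one" "mat_mult UNIV (mat_adjoint B) B = mat_one"
    using assms by (simp_all add: unitary_def mat_eq_UNIV)
  then have "mat_mult UNIV (direct_sum A B) (mat_adjoint (direct_sum A B)) = mat_one"
    "mat_mult UNIV (mat_adjoint (direct_sum A B)) (direct_sum A B) = mat_one"
    by (simp_all add: mat_adjoint_direct_sum mat_mult_direct_sum flip: mat_one_direct_sum)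
  then show ?thesis
    by (simp add: unitary_def mat_eq_def)
qed

section \<open>The index set as a folded disjoint union\<close>

lemma orbit_section_cover: "orbit_section \<theta> X \<Longrightarrow> g \<in> fixed \<theta> \<or> g \<in> X \<or> g \<in> \<theta> ` X"
  by (metis orbit_section_def UNIV_I UnE)

lemma orbit_section_disjoint:
  assumes "orbit_section \<theta> X"
  shows "\<not> (g \<in> fixed \<theta> \<and> g \<in> X)" "\<not> (g \<in> fixed \<theta> \<and> g \<in> \<theta> ` X)"
    "\<not> (g \<in> X \<and> g \<in> \<theta> ` X)"
  using assms by (metis orbit_section_def IntI empty_iff)+

text \<open>This is the column relation of \<open>R\<close> within one group. The factor 2 counts
  the rows \<open>U0 u\<close> and \<open>Upi u\<close>. A fixed \<open>g\<close> meets only these;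
  any other \<open>g\<close> meets exactly one \<open>x\<close> in \<open>X\<close>, whose row is
  supported on the orbit of \<open>g\<close>.\<close>

lemma sum_orbits:
  fixes \<theta> :: "'a::finite \<Rightarrow> 'a"
  assumes sec: "orbit_section \<theta> X" and inv: "\<And>g. \<theta> (\<theta> g) = g"
  shows "2 * (\<Sum>u\<in>fixed \<theta>. of_bool (g = u) * of_bool (h = u)) +
      (\<Sum>x\<in>X. (of_bool (g = x) + of_bool (g = \<theta> x)) * (of_bool (h = x) + of_bool (h = \<theta> x))) =
    (if h = g then 1 else 0) + (if h = \<theta> g then 1 else (0::complex))"
proof -
  have theta_eq: "g = \<theta> x \<longleftrightarrow> x = \<theta> g" for g x
    using inv by metis
  have swap: "\<theta> y \<in> X \<longleftrightarrow> y \<in> \<theta> ` X" for y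
    using inv by (metis imageE image_eqI)
  have fold: "(\<Sum>x\<in>A. of_bool (g = x) * F x) = (if g \<in> A then F g else 0)" for A g and F :: "'a \<Rightarrow> complex"
  proof -
    have "of_bool (g = x) * F x = (if g = x then F x else 0)" for x
      by simp
    then show ?thesis
      by simp
  qed
  have "(\<Sum>x\<in>X. (of_bool (g = x) + of_bool (g = \<theta> x)) * (of_bool (h = x) + of_bool (h = \<theta> x))) =
      (\<Sum>x\<in>X. of_bool (g = x) * (of_bool (h = x) + of_bool (h = \<theta> x))) +
      (\<Sum>x\<in>X. of_bool (\<theta> g = x) * (of_bool (h = x) + of_bool (h = \<theta> x) :: complex))"
    unfolding sum.distrib[symmetric]
    by (rule sum.cong) (auto simp: theta_eq[of g] distrib_right)
  also have "\<dots> = (if g \<in> X then of_bool (h = g) + of_bool (h = \<theta> g) else 0) +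
      (if \<theta> g \<in> X then of_bool (h = \<theta> g) + of_bool (h = g) else 0)"
    by (simp add: fold inv)
  finally have X: "(\<Sum>x\<in>X. (of_bool (g = x) + of_bool (g = \<theta> x)) * (of_bool (h = x) + of_bool (h = \<theta> x))) =
      (if g \<in> X then of_bool (h = g) + of_bool (h = \<theta> g) else 0) +
      (if \<theta> g \<in> X then of_bool (h = \<theta> g) + of_bool (h = g) else (0::complex))" .
  consider "g \<in> fixed \<theta>" "g \<notin> X" "\<theta> g \<notin> X" | "g \<notin> fixed \<theta>" "g \<in> X" "\<theta> g \<notin> X"
    | "g \<notin> fixed \<theta>" "g \<notin> X" "\<theta> g \<in> X"
    using orbit_section_cover[OF sec, of g] orbit_section_disjoint[OF sec, of g] unfolding swap by metis
  then show ?thesis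
    unfolding X fold by cases (auto simp: fixed_def)
qed

text \<open>Since \<open>x\<close> is not fixed, neither is \<open>- x\<close>, which therefore lies
  in the image of \<open>X\<close>. This makes the second case of \<open>index_bar\<close> land in
  the section.\<close>

lemma theta_uminus_in_section:
  fixes X :: "'a::ab_group_add set"
  assumes "orbit_section \<theta> X" "\<And>g. \<theta> (\<theta> g) = g" "\<And>g. \<theta> (- g) = - \<theta> g" "x \<in> X" "- x \<notin> X"
  shows "\<theta> (- x) \<in> X"
proof -
  have "x \<notin> fixed \<theta>"
    using orbit_section_disjoint(1)[OF assms(1)] assms(4) by blast
  then have "- x \<notin> fixed \<theta>"
    using assms(3) by (simp add: fixed_def)
  then obtain w where "- x = \<theta> w" "w \<in> X"
    using orbit_section_cover[OF assms(1), of "- x"] assms(5) by blast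
  then show ?thesis
    by (simp add: assms(2))
qed

text \<open>
  This is \<open>R\<close>. The vectors \<open>U0 u + Upi u\<close> and \<open>U0 u - Upi u\<close> span the copies of \<open>u\<close> in \<open>G\<close> and
  \<open>\<Gamma>\<close>. The sign on \<open>InGamma\<close> is forced by the entry \<open>+b\<close> of \<open>S\<close> at \<open>(U0, InGamma)\<close>, against \<open>-b\<close> on
  the block \<open>(InGamma, InGamma)\<close>.
\<close>

fun fold_matrix :: "('g \<Rightarrow> 'g) \<Rightarrow> ('h \<Rightarrow> 'h) \<Rightarrow> ('g \<Rightarrow> 'h) \<Rightarrow> ('g, 'h) index \<Rightarrow> 'g + 'h \<Rightarrow> complex" where
  "fold_matrix \<theta>1 \<theta>2 \<phi> (U0 u) (Inl g) = of_bool (g = u)"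
| "fold_matrix \<theta>1 \<theta>2 \<phi> (U0 u) (Inr \<gamma>) = of_bool (\<gamma> = \<phi> u)"
| "fold_matrix \<theta>1 \<theta>2 \<phi> (Upi u) (Inl g) = of_bool (g = u)"
| "fold_matrix \<theta>1 \<theta>2 \<phi> (Upi u) (Inr \<gamma>) = - of_bool (\<gamma> = \<phi> u)"
| "fold_matrix \<theta>1 \<theta>2 \<phi> (InG x) (Inl g) = of_bool (g = x) + of_bool (g = \<theta>1 x)"
| "fold_matrix \<theta>1 \<theta>2 \<phi> (InG x) (Inr \<gamma>) = 0"
| "fold_matrix \<theta>1 \<theta>2 \<phi> (InGamma y) (Inl g) = 0"
| "fold_matrix \<theta>1 \<theta>2 \<phi> (InGamma y) (Inr \<gamma>) = - (of_bool (\<gamma> = y) + of_bool (\<gamma> = \<theta>2 y))"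

lemma sum_of_bool_UNIV:
  fixes f :: "'a::finite \<Rightarrow> complex"
  shows "(\<Sum>k\<in>UNIV. of_bool (k = x) * f k) = f x"
proof -
  have "of_bool (k = x) * f k = (if k = x then f k else 0)" for k
    by simp
  then show ?thesis
    by simp
qed

lemma sum_fold_matrix:
  fixes \<theta>1 :: "'g::finite \<Rightarrow> 'g" and \<theta>2 :: "'h::finite \<Rightarrow> 'h"
  shows "(\<Sum>k\<in>UNIV. fold_matrix \<theta>1 \<theta>2 \<phi> (U0 u) k * f k) = f (Inl u) + f (Inr (\<phi> u))"
    and "(\<Sum>k\<in>UNIV. fold_matrix \<theta>1 \<theta>2 \<phi> (Upi u) k * f k) = f (Inl u) - f (Inr (\<phi> u))"
    and "(\<Sum>k\<in>UNIV. fold_matrix \<theta>1 \<theta>2 \<phi> (InG x) k * f k) = f (Inl x) + f (Inl (\<theta>1 x))"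
    and "(\<Sum>k\<in>UNIV. fold_matrix \<theta>1 \<theta>2 \<phi> (InGamma y) k * f k) = - f (Inr y) - f (Inr (\<theta>2 y))"
  by (simp_all add: sum_UNIV_plus sum_of_bool_UNIV distrib_right sum.distrib sum_negf
      left_diff_distrib sum_subtractf)

lemma sum_index_set:
  fixes \<theta>1 :: "'g::finite \<Rightarrow> 'g" and \<Gamma>s :: "'h::finite set" and f :: "('g, 'h) index \<Rightarrow> complex"
  shows "(\<Sum>z\<in>index_set \<theta>1 Gs \<Gamma>s. f z) =
    (\<Sum>u\<in>fixed \<theta>1. f (U0 u)) + (\<Sum>u\<in>fixed \<theta>1. f (Upi u)) +
    (\<Sum>g\<in>Gs. f (InG g)) + (\<Sum>\<gamma>\<in>\<Gamma>s. f (InGamma \<gamma>))"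
  unfolding index_set_def
  by (subst sum.union_disjoint; (force simp: sum.reindex inj_on_def)?)+

section \<open>The relations of \<open>R\<close> for a pair of involutive metric groups\<close>

locale folded_pair =
  fixes q1 :: "'g::{finite,ab_group_add} \<Rightarrow> complex" and \<theta>1 :: "'g \<Rightarrow> 'g"
    and q2 :: "'h::{finite,ab_group_add} \<Rightarrow> complex" and \<theta>2 :: "'h \<Rightarrow> 'h"
    and \<phi> :: "'g \<Rightarrow> 'h" and Gs :: "'g set" and \<Gamma>s :: "'h set"
  assumes img1: "involutive_metric_group q1 \<theta>1"
    and img2: "involutive_metric_group q2 \<theta>2"
    and iso: "fixed_group_iso q1 \<theta>1 q2 \<theta>2 \<phi>"
    and sec1: "orbit_section \<theta>1 Gs"
    and sec2: "orbit_section \<theta>2 \<Gamma>s"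
begin

abbreviation "J \<equiv> index_set \<theta>1 Gs \<Gamma>s"
abbreviation "R \<equiv> fold_matrix \<theta>1 \<theta>2 \<phi>"

lemma metric_groups: "metric_group q1" "metric_group q2"
  using img1 img2 by (simp_all add: involutive_metric_group_def)

lemma theta_theta [simp]: "\<theta>1 (\<theta>1 g) = g" "\<theta>2 (\<theta>2 \<gamma>) = \<gamma>"
  using img1 img2 by (metis involutive_metric_group_def comp_apply id_apply)+

lemma q_theta [simp]: "q1 (\<theta>1 g) = q1 g" "q2 (\<theta>2 \<gamma>) = q2 \<gamma>"
  using img1 img2 by (metis involutive_metric_group_def comp_apply)+

lemma theta_uminus: "\<theta>1 (- g) = - \<theta>1 g" "\<theta>2 (- \<gamma>) = - \<theta>2 \<gamma>"
  using img1 img2 by (simp_all add: involutive_metric_group_def additive.minus)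

lemma theta_fixed: "u \<in> fixed \<theta>1 \<Longrightarrow> \<theta>1 u = u" "v \<in> fixed \<theta>2 \<Longrightarrow> \<theta>2 v = v"
  by (simp_all add: fixed_def)

lemma theta_eq_iff: "\<theta>1 g = \<theta>1 g' \<longleftrightarrow> g = g'" "\<theta>2 \<gamma> = \<theta>2 \<gamma>' \<longleftrightarrow> \<gamma> = \<gamma>'"
  by (metis theta_theta)+

lemma eq_theta_iff: "\<theta>1 g = g' \<longleftrightarrow> g = \<theta>1 g'" "\<theta>2 \<gamma> = \<gamma>' \<longleftrightarrow> \<gamma> = \<theta>2 \<gamma>'"
  by (metis theta_theta)+

lemma phi_fixed: "u \<in> fixed \<theta>1 \<Longrightarrow> \<phi> u \<in> fixed \<theta>2"
  using iso by (meson fixed_group_iso_def bij_betwE)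

lemma phi_inj: "u \<in> fixed \<theta>1 \<Longrightarrow> v \<in> fixed \<theta>1 \<Longrightarrow> \<phi> u = \<phi> v \<longleftrightarrow> u = v"
  using iso by (auto simp: fixed_group_iso_def bij_betw_def inj_on_def)

lemma q_phi: "u \<in> fixed \<theta>1 \<Longrightarrow> q2 (\<phi> u) = q1 u"
  using iso by (simp add: fixed_group_iso_def)

lemma phi_add: "u \<in> fixed \<theta>1 \<Longrightarrow> v \<in> fixed \<theta>1 \<Longrightarrow> \<phi> (u + v) = \<phi> u + \<phi> v"
  using iso by (simp add: fixed_group_iso_def)

lemma fixed_closed:
  "u \<in> fixed \<theta>1 \<Longrightarrow> v \<in> fixed \<theta>1 \<Longrightarrow> u + v \<in> fixed \<theta>1"
  "u \<in> fixed \<theta>1 \<Longrightarrow> - u \<in> fixed \<theta>1"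
  using img1 by (simp_all add: fixed_def theta_uminus involutive_metric_group_def additive.add)

lemma phi_uminus:
  assumes "u \<in> fixed \<theta>1"
  shows "\<phi> (- u) = - \<phi> u"
proof -
  have "0 \<in> fixed \<theta>1"
    using fixed_closed[OF assms] fixed_closed(1)[OF assms, of "- u"] by simp
  then have "\<phi> 0 = 0"
    using phi_add[of 0 0] by simp
  then show ?thesis
    using phi_add[of u "- u"] assms fixed_closed by (simp add: eq_neg_iff_add_eq_0 add.commute)
qed

lemma pairing_phi:
  "u \<in> fixed \<theta>1 \<Longrightarrow> v \<in> fixed \<theta>1 \<Longrightarrow> pairing q2 (\<phi> u) (\<phi> v) = pairing q1 u v"
  by (simp add: pairing_def q_phi fixed_closed flip: phi_add)

lemma pairing_theta:
  "pairing q1 (\<theta>1 g) h = pairing q1 g (\<theta>1 h)" "pairing q2 (\<theta>2 \<gamma>) \<eta> = pairing q2 \<gamma> (\<theta>2 \<eta>)"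
  using pairing_involution[OF img1, of g "\<theta>1 h"] pairing_involution[OF img2, of \<gamma> "\<theta>2 \<eta>"] by simp_all

lemma pairing_theta_fixed:
  "u \<in> fixed \<theta>1 \<Longrightarrow> pairing q1 u (\<theta>1 g) = pairing q1 u g"
  "v \<in> fixed \<theta>2 \<Longrightarrow> pairing q2 v (\<theta>2 \<gamma>) = pairing q2 v \<gamma>"
  by (metis pairing_theta theta_fixed)+

sublocale compression J R "map_sum \<theta>1 \<theta>2"
proof
  fix k :: "'g + 'h" and x :: "('g, 'h) index"
  show "map_sum \<theta>1 \<theta>2 (map_sum \<theta>1 \<theta>2 k) = k"
    by (cases k) simp_all
  show "cnj (R x k) = R x k"
    by (cases x; cases k) simp_all
  assume x: "x \<in> J"
  show "R x (map_sum \<theta>1 \<theta>2 k) = R x k"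
    using x by (cases k) (auto simp: index_set_def theta_fixed phi_fixed theta_eq_iff eq_theta_iff)
next
  fix x y :: "('g, 'h) index"
  assume "x \<in> J" "y \<in> J"
  \<comment> \<open>These inequalities keep the supports of rows of different orbits disjoint and
    the two points of a nontrivial orbit distinct. So each row has squared length 2; the rows
    \<open>U0 u\<close> and \<open>Upi u\<close> are orthogonal because their common points
    contribute 1 and -1.\<close>
  moreover have "u \<noteq> g" "u \<noteq> \<theta>1 g" "g \<noteq> u" "\<theta>1 g \<noteq> u" if "u \<in> fixed \<theta>1" "g \<in> Gs" for u g
    using sec1 that by (auto simp: orbit_section_def)
  moreover have "v \<noteq> \<gamma>" "v \<noteq> \<theta>2 \<gamma>" "\<gamma> \<noteq> v" "\<theta>2 \<gamma> \<noteq> v" if "v \<in> fixed \<theta>2" "\<gamma> \<in> \<Gamma>s" for v \<gamma>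
    using sec2 that by (auto simp: orbit_section_def)
  moreover have "g \<noteq> \<theta>1 g'" "\<theta>1 g \<noteq> g'" if "g \<in> Gs" "g' \<in> Gs" for g g'
    using sec1 that by (auto simp: orbit_section_def)
  moreover have "\<gamma> \<noteq> \<theta>2 \<gamma>'" "\<theta>2 \<gamma> \<noteq> \<gamma>'" if "\<gamma> \<in> \<Gamma>s" "\<gamma>' \<in> \<Gamma>s" for \<gamma> \<gamma>'
    using sec2 that by (auto simp: orbit_section_def)
  ultimately show "(\<Sum>k\<in>UNIV. R x k * R y k) = (if x = y then 2 else 0)"
    unfolding index_set_def
    by (elim UnE imageE) (simp_all add: sum_fold_matrix phi_inj theta_eq_iff phi_fixed)
next
  fix k l :: "'g + 'h"
  have phi: "(\<Sum>u\<in>fixed \<theta>1. f (\<phi> u)) = (\<Sum>v\<in>fixed \<theta>2. f v)" for f :: "'h \<Rightarrow> complex"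
    using iso by (intro sum.reindex_bij_betw) (simp add: fixed_group_iso_def)
  show "(\<Sum>z\<in>J. R z k * R z l) =
      (if l = k then 1 else 0) + (if l = map_sum \<theta>1 \<theta>2 k then 1 else 0)"
  proof (cases k; cases l)
    fix g h assume "k = Inl g" "l = Inl h"
    then show ?thesis
      using sum_orbits[OF sec1, of g h] by (simp add: sum_index_set)
  next
    fix g h assume "k = Inr g" "l = Inr h"
    \<comment> \<open>Within the second group the signs of \<open>Upi\<close> and
      \<open>InGamma\<close> rows occur twice in each product and cancel.\<close>
    then have "(\<Sum>z\<in>J. R z k * R z l) =
        2 * (\<Sum>u\<in>fixed \<theta>1. of_bool (g = \<phi> u) * of_bool (h = \<phi> u)) +
        (\<Sum>x\<in>\<Gamma>s. (of_bool (g = x) + of_bool (g = \<theta>2 x)) * (of_bool (h = x) + of_bool (h = \<theta>2 x)))"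
      by (simp only: sum_index_set fold_matrix.simps minus_mult_minus mult_zero_left
          sum.neutral_const mult_2 add_0_right)
    also have "\<dots> = (if h = g then 1 else 0) + (if h = \<theta>2 g then 1 else 0)"
      unfolding phi[of "\<lambda>v. of_bool (g = v) * of_bool (h = v)"]
      by (rule sum_orbits[OF sec2]) simp
    finally show ?thesis
      using \<open>k = Inr g\<close> \<open>l = Inr h\<close> by simp
  \<comment> \<open>For points of different groups only the rows of \<open>U\<close> contribute, and
    those of \<open>U0 u\<close> and \<open>Upi u\<close> cancel.\<close>
  qed (simp_all add: sum_index_set sum_negf)
qed

section \<open>\<open>T\<close>, \<open>S\<close> and \<open>C\<close> as compressions\<close>

lemma compresses_T: "compresses (direct_sum (mat_diag q1) (mat_diag q2)) (T_mat q1 q2)"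
proof -
  have "T_mat q1 q2 x y = compress R (mat_diag (case_sum q1 q2)) x y" if "x \<in> J" "y \<in> J" for x y
  proof -
    \<comment> \<open>Each row of \<open>R\<close> is an eigenvector of the diagonal matrix:
      \<open>q1\<close> and \<open>q2\<close> are constant on orbits, and \<open>\<phi>\<close>
      matches their values on \<open>U\<close>. Hence \<open>R_rows\<close> finishes the
      computation.\<close>
    have eigen: "case_sum q1 q2 k * R x k = T_entry q1 q2 x * R x k" for k
      using \<open>x \<in> J\<close> by (cases k) (auto simp: index_set_def q_phi)
    have "compress R (mat_diag (case_sum q1 q2)) x y =
        (\<Sum>k\<in>UNIV. (case_sum q1 q2 k * R x k) * R y k) / 2"
      by (simp add: compress_def mat_diag_def if_distrib ac_simps cong: if_cong)
    also have "\<dots> = T_entry q1 q2 x * (\<Sum>k\<in>UNIV. R x k * R y k) / 2"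
      by (simp add: eigen sum_distrib_left mult.assoc)
    also have "\<dots> = mat_diag (T_entry q1 q2) x y"
      by (simp add: R_rows that mat_diag_def)
    finally show ?thesis
      by (simp add: T_mat_def)
  qed
  moreover have "mat_diag (case_sum q1 q2) (map_sum \<theta>1 \<theta>2 k) (map_sum \<theta>1 \<theta>2 l) =
      mat_diag (case_sum q1 q2) k l" for k l
    by (cases k; cases l) (simp_all add: mat_diag_def theta_eq_iff)
  ultimately show ?thesis
    by (simp add: compresses_def mat_eq_def flip: mat_diag_direct_sum)
qed

text \<open>Every entry is a sum of at most four brackets. For two rows of \<open>U\<close>,
  \<open>\<phi>\<close> identifies the brackets of the groups, giving \<open>a - b\<close> or
  \<open>a + b\<close> over 2. When an orbit row is involved, equal brackets occur in pairs and
  cancel the half; the signs of \<open>R\<close> and of the second summand combine to those of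
  \<open>S\<close>.\<close>

lemma compresses_S:
  "compresses (direct_sum (fourier q1) (mat_scale (-1) (fourier q2))) (S_mat q1 \<theta>1 q2 \<theta>2 \<phi>)"
  (is "compresses ?Z _")
proof -
  have "?Z (map_sum \<theta>1 \<theta>2 k) (map_sum \<theta>1 \<theta>2 l) = ?Z k l" for k l
    by (cases k; cases l) (simp_all add: fourier_def mat_scale_def pairing_theta)
  moreover have "S_mat q1 \<theta>1 q2 \<theta>2 \<phi> x y = compress R ?Z x y" if "x \<in> J" "y \<in> J" for x y
  proof -
    have "S_mat q1 \<theta>1 q2 \<theta>2 \<phi> =
        S_blocks (fourier_scale TYPE('g)) (fourier_scale TYPE('h)) q1 \<theta>1 q2 \<theta>2 \<phi>"
      by (simp add: S_mat_def fourier_scale_def)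
    then show ?thesis
      using that unfolding index_set_def
      by (auto simp: compress_def sum_fold_matrix fourier_def mat_scale_def pairing_theta theta_fixed
          phi_fixed pairing_phi pairing_theta_fixed; simp add: field_simps)
  qed
  ultimately show ?thesis
    by (simp add: compresses_def mat_eq_def)
qed

lemma index_bar_in_J:
  assumes "y \<in> J"
  shows "index_bar \<theta>1 Gs \<theta>2 \<Gamma>s y \<in> J"
  using assms theta_uminus_in_section[OF sec1 theta_theta(1) theta_uminus(1)]
    theta_uminus_in_section[OF sec2 theta_theta(2) theta_uminus(2)]
  unfolding index_set_def by (elim UnE imageE) (simp_all add: fixed_closed image_iff)

lemma compresses_C: "compresses (direct_sum negation negation) (C_mat \<theta>1 Gs \<theta>2 \<Gamma>s)"
  (is "compresses ?Z _")
proof -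
  have "?Z (map_sum \<theta>1 \<theta>2 k) (map_sum \<theta>1 \<theta>2 l) = ?Z k l" for k l
    by (cases k; cases l) (simp_all add: negation_def theta_eq_iff flip: theta_uminus)
  moreover have "C_mat \<theta>1 Gs \<theta>2 \<Gamma>s x y = compress R ?Z x y" if "x \<in> J" "y \<in> J" for x y
  proof -
    let ?m = "map_sum uminus uminus :: 'g + 'h \<Rightarrow> 'g + 'h"
    let ?y = "index_bar \<theta>1 Gs \<theta>2 \<Gamma>s y"
    have [simp]: "- g = g' \<longleftrightarrow> g = - g'" "- \<gamma> = \<gamma>' \<longleftrightarrow> \<gamma> = - \<gamma>'" for g g' :: 'g and \<gamma> \<gamma>' :: 'h
      by auto
    \<comment> \<open>Negation carries the row of \<open>y\<close> to that of its conjugate. Whether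
      \<open>index_bar\<close> picks \<open>- g\<close> or its image under the involution is
      immaterial, as a row depends only on the orbit.\<close>
    have bar: "R y (?m k) = R ?y k" for k
      using \<open>y \<in> J\<close>
      by (cases k) (auto simp: index_set_def theta_uminus phi_uminus)
    have Z: "?Z = (\<lambda>k l. if l = ?m k then 1 else 0)"
    proof (intro ext)
      fix k l
      show "?Z k l = (if l = ?m k then 1 else 0)"
        by (cases k; cases l) (auto simp: negation_def)
    qed
    have "compress R ?Z x y = (\<Sum>k\<in>UNIV. R x k * R y (?m k)) / 2"
      by (simp add: compress_def Z if_distrib cong: if_cong)
    also have "\<dots> = C_mat \<theta>1 Gs \<theta>2 \<Gamma>s x y"
      by (simp add: bar R_rows that index_bar_in_J C_mat_def)
    finally show ?thesis ..
  qed
  ultimately show ?thesis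
    by (simp add: compresses_def mat_eq_def)
qed

end

section \<open>Transfer of the Weil relations to \<open>S\<close>, \<open>T\<close> and
  \<open>C\<close>\<close>

theorem lemma3p4:
  fixes q1 :: "'g::{finite,ab_group_add} \<Rightarrow> complex" and \<theta>1 :: "'g \<Rightarrow> 'g"
    and q2 :: "'h::{finite,ab_group_add} \<Rightarrow> complex" and \<theta>2 :: "'h \<Rightarrow> 'h"
    and \<phi> :: "'g \<Rightarrow> 'h"
    and Gs :: "'g set" and \<Gamma>s :: "'h set"
    and c :: complex
    and J :: "('g, 'h) index set"
    and S T C :: "('g, 'h) index cmatrix"
  assumes "involutive_metric_group q1 \<theta>1"
    and "involutive_metric_group q2 \<theta>2"
    and "c = gauss_sum q1"
    and "gauss_sum q1 = - gauss_sum q2"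
    and "fixed_group_iso q1 \<theta>1 q2 \<theta>2 \<phi>"
    and "orbit_section \<theta>1 Gs"
    and "orbit_section \<theta>2 \<Gamma>s"
    and "J = index_set \<theta>1 Gs \<Gamma>s"
    and "S = S_mat q1 \<theta>1 q2 \<theta>2 \<phi>"
    and "T = T_mat q1 q2"
    and "C = C_mat \<theta>1 Gs \<theta>2 \<Gamma>s"
  shows "unitary J S \<and> unitary J T \<and> unitary J C \<and>
         mat_eq J (mat_power J S 2) C \<and>
         mat_eq J (mat_power J (mat_mult J S T) 3) (mat_scale c C) \<and>
         mat_eq J (mat_mult J T C) (mat_mult J C T)"
proof -
  interpret folded_pair q1 \<theta>1 q2 \<theta>2 \<phi> Gs \<Gamma>s
    by (intro folded_pair.intro assms)
  let ?S = "direct_sum (fourier q1) (mat_scale (-1) (fourier q2))"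
  let ?T = "direct_sum (mat_diag q1) (mat_diag q2)"
  let ?C = "direct_sum negation negation :: ('g + 'h) cmatrix"
  have S: "compresses ?S S" and T: "compresses ?T T" and C: "compresses ?C C"
    using assms compresses_S compresses_T compresses_C by simp_all
  have "unitary UNIV ?S" "unitary UNIV ?T" "unitary UNIV ?C"
    \<comment> \<open>Unfolding exhibits \<open>negation\<close> as the permutation matrix of an
      involution.\<close>
    unfolding negation_def
    by (intro unitary_direct_sum unitary_fourier unitary_mat_diag unitary_permutation
        unitary_uminus metric_groups; simp add: metric_group_norm metric_groups)+
  then have "unitary J S" "unitary J T" "unitary J C"
    using S T C compresses_unitary assms(8) by blast+
  \<comment> \<open>The sign on the second summand disappears in the square.\<close>
  moreover have "mat_power UNIV ?S 2 = ?C"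
    by (simp add: mat_power_direct_sum mat_mult_direct_sum eval_nat_numeral mat_mult_one_right mat_scale_mult
        mat_scale_scale mat_scale_one fourier_sq metric_groups)
  then have "mat_eq J (mat_power J S 2) C"
    using compresses_eq compresses_power[OF S, of 2] C assms(8) by metis
  \<comment> \<open>Here the sign survives: the second summand acquires
    \<open>(-1) ^ 3 * gauss_sum q2\<close>, which equals \<open>c\<close> since the Gauss sums are
    opposite.\<close>
  moreover have "mat_power UNIV (mat_mult UNIV ?S ?T) 3 = mat_scale c ?C"
    using assms(3,4)
    by (simp add: mat_power_direct_sum mat_mult_direct_sum mat_scale_direct_sum mat_scale_mult
        mat_power_scale fourier_diag_cube metric_groups mat_scale_scale)
  then have "mat_eq J (mat_power J (mat_mult J S T) 3) (mat_scale c C)"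
    using compresses_eq compresses_power[OF compresses_mult[OF S T], of 3] compresses_scale[OF C]
      assms(8) by metis
  moreover have "mat_mult UNIV ?T ?C = mat_mult UNIV ?C ?T"
    by (simp add: mat_mult_direct_sum diag_negation_commute metric_groups)
  then have "mat_eq J (mat_mult J T C) (mat_mult J C T)"
    using compresses_eq compresses_mult[OF T C] compresses_mult[OF C T] assms(8) by metis
  ultimately show ?thesis
    by blast
qed

end
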